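(* Let $n>3$. The dynamics group $G_{73}$ of Wolfram rule $73$ on the circular graph with $n$ vertices is the projection of $G_{201}$ into the direct product \[ G_{73}\subset \mathrm{LG}_n\times\prod_{\ell=1}^{n}\left(\mathrm{FG}_{n-2}^{(\ell)}\times\prod_{m=3}^{n-5}\mathrm{FG}_m^{(\ell)}\right); \] that is, $G_{73}$ is isomorphic to the image of $G_{201}$ in this product under the homomorphism sending $g\in G_{201}$ to the tuple of its restrictions to the orbits defining the factors.
   Context: Indices are taken modulo $n$. Wolfram rule $201$: for $1\le i\le n$, $F_i^{(201)}\colon\mathbb{F}_2^n\to\mathbb{F}_2^n$ changes $y_i$ to $1-y_i$ if $y_{i-1}=y_{i+1}=0$ and otherwise leaves $\mathbf{y}$ unchanged. Wolfram rule $73$: $F_i^{(73)}$ changes $y_i$ to $1-y_i$ if $y_{i-1}=y_{i+1}=0$, sets $y_i$ to $0$ if $y_{i-1}=y_{i+1}=1$, and otherwise leaves $\mathbf{y}$ unchanged. In both cases only the $i$-th coordinate can change. Both rules are $\pi$-independent: for a simple update order $\pi$ (a sequence $\pi_1,\dots,\pi_n$ containing each of $1,\dots,n$ exactly once) the set of periodic states of $F_{\pi_n}\circ\cdots\circ F_{\pi_1}$ does not depend on $\pi$. Denote this set $P_k$ for rule $k$; each $F_i^{(k)}$ permutes $P_k$, and the dynamics group $G_k$ is the group of permutations of $P_k$ generated by the restrictions of $F_1^{(k)},\dots,F_n^{(k)}$ to $P_k$. For rule $201$, $P_{201}=\mathbb{F}_2^n$. The Lucas group $\mathrm{LG}_n$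 is the permutation group obtained by restricting $G_{201}$ to the orbit of the all-zero state. For $1\le m\le n-2$ and $1\le\ell\le n$, the Fibonacci group $\mathrm{FG}_m^{(\ell)}$ is the permutation group obtained by restricting $G_{201}$ to the orbit of the state $\mathbf{y}$ with $y_\ell=y_{\ell+1}=\dots=y_{\ell+m-1}=0$ (indices mod $n$) and all other coordinates equal to $1$. Empty products are trivial. *)

theory Defs
  imports "HOL-Algebra.Algebra" "HOL-Library.Z2"
begin

section \<open>Asynchronous cellular automata on the circular graph\<close>

type_synonym state = "nat \<Rightarrow> bit"

definition states :: "nat \<Rightarrow> state set" where
  "states n = {1..n} \<rightarrow>\<^sub>E UNIV"

definition prv :: "nat \<Rightarrow> nat \<Rightarrow> nat" where
  "prv n i = (if i = 1 then n else i - 1)"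

definition nxt :: "nat \<Rightarrow> nat \<Rightarrow> nat" where
  "nxt n i = (if i = n then 1 else i + 1)"

text \<open>A rule maps the values (left neighbour, vertex, right neighbour) to the new value of the
  vertex.\<close>

type_synonym rule = "bit \<Rightarrow> bit \<Rightarrow> bit \<Rightarrow> bit"

definition rule201 :: rule where
  "rule201 a b c = (if a = 0 \<and> c = 0 then 1 - b else b)"

definition rule73 :: rule where
  "rule73 a b c = (if a = 0 \<and> c = 0 then 1 - b else if a = 1 \<and> c = 1 then 0 else b)"

definition local_update :: "rule \<Rightarrow> nat \<Rightarrow> nat \<Rightarrow> state \<Rightarrow> state" where
  "local_update r n i y = y(i := r (y (prv n i)) (y i) (y (nxt n i)))"

definition simple_update_order :: "nat \<Rightarrow> nat list \<Rightarrow> bool" where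
  "simple_update_order n \<pi> \<longleftrightarrow> distinct \<pi> \<and> set \<pi> = {1..n}"

text \<open>Since \<^const>\<open>fold\<close> processes the list from the left, the first entry of the
  order is updated first.\<close>

definition system_map :: "rule \<Rightarrow> nat \<Rightarrow> nat list \<Rightarrow> state \<Rightarrow> state" where
  "system_map r n \<pi> = fold (local_update r n) \<pi>"

definition periodic_states_wrt :: "rule \<Rightarrow> nat \<Rightarrow> nat list \<Rightarrow> state set" where
  "periodic_states_wrt r n \<pi> = {y \<in> states n. \<exists>k>0. (system_map r n \<pi> ^^ k) y = y}"

text \<open>The periodic states are defined with the order \<open>1, \<dots>, n\<close>; the results
  \<open>periodic_states_201_independent\<close> and \<open>periodic_states_73_independent\<close> below show that any other
  simple update order gives the same set.\<close>

definition periodic_states :: "rule \<Rightarrow> nat \<Rightarrow> state set" where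
  "periodic_states r n = periodic_states_wrt r n [1..<Suc n]"

definition dynamics_group :: "rule \<Rightarrow> nat \<Rightarrow> (state \<Rightarrow> state) monoid" where
  "dynamics_group r n =
     subgroup_generated (BijGroup (periodic_states r n))
       ((\<lambda>i. restrict (local_update r n i) (periodic_states r n)) ` {1..n})"


section \<open>Lucas and Fibonacci groups\<close>

text \<open>Elements of \<^const>\<open>BijGroup\<close> are extensional functions, so the restriction of a permutation to
  an invariant subset is \<^const>\<open>restrict\<close>.\<close>

definition restricted_group :: "('a \<Rightarrow> 'a) monoid \<Rightarrow> 'a set \<Rightarrow> ('a \<Rightarrow> 'a) monoid" where
  "restricted_group G S = (BijGroup S)\<lparr>carrier := (\<lambda>g. restrict g S) ` carrier G\<rparr>"

definition zero_state :: "nat \<Rightarrow> state" where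
  "zero_state n = (\<lambda>i\<in>{1..n}. 0)"

definition zero_block_state :: "nat \<Rightarrow> nat \<Rightarrow> nat \<Rightarrow> state" where
  "zero_block_state n m l = (\<lambda>i\<in>{1..n}. if \<exists>k<m. i mod n = (l + k) mod n then 0 else 1)"

definition orbit201 :: "nat \<Rightarrow> state \<Rightarrow> state set" where
  "orbit201 n y = orbit (dynamics_group rule201 n) (\<lambda>g. g) y"

definition lucas_orbit :: "nat \<Rightarrow> state set" where
  "lucas_orbit n = orbit201 n (zero_state n)"

definition fibonacci_orbit :: "nat \<Rightarrow> nat \<Rightarrow> nat \<Rightarrow> state set" where
  "fibonacci_orbit n m l = orbit201 n (zero_block_state n m l)"

definition lucas_group :: "nat \<Rightarrow> (state \<Rightarrow> state) monoid" where
  "lucas_group n = restricted_group (dynamics_group rule201 n) (lucas_orbit n)"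

definition fibonacci_group :: "nat \<Rightarrow> nat \<Rightarrow> nat \<Rightarrow> (state \<Rightarrow> state) monoid" where
  "fibonacci_group n m l = restricted_group (dynamics_group rule201 n) (fibonacci_orbit n m l)"


section \<open>The direct product and the projection into it\<close>

text \<open>For \<open>n < 5\<close> the truncated \<open>n - 5\<close> is \<open>0\<close>, so \<open>{3..n - 5}\<close> is empty, as it should be.\<close>

definition lucas_fibonacci_product ::
  "nat \<Rightarrow> ((state \<Rightarrow> state) \<times> (nat \<Rightarrow> (state \<Rightarrow> state) \<times> (nat \<Rightarrow> state \<Rightarrow> state))) monoid" where
  "lucas_fibonacci_product n =
     lucas_group n \<times>\<times>
     product_group {1..n} (\<lambda>l.
       fibonacci_group n (n - 2) l \<times>\<times> product_group {3..n - 5} (\<lambda>m. fibonacci_group n m l))"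

definition orbit_projection ::
  "nat \<Rightarrow> (state \<Rightarrow> state) \<Rightarrow>
     (state \<Rightarrow> state) \<times> (nat \<Rightarrow> (state \<Rightarrow> state) \<times> (nat \<Rightarrow> state \<Rightarrow> state))" where
  "orbit_projection n g =
     (restrict g (lucas_orbit n),
      \<lambda>l\<in>{1..n}. (restrict g (fibonacci_orbit n (n - 2) l),
                   \<lambda>m\<in>{3..n - 5}. restrict g (fibonacci_orbit n m l)))"


section \<open>Independence of the update order\<close>

lemma prv_mem: "i \<in> {1..n} \<Longrightarrow> prv n i \<in> {1..n}"
  and nxt_mem: "i \<in> {1..n} \<Longrightarrow> nxt n i \<in> {1..n}"
  by (auto simp: prv_def nxt_def)

lemma prv_neq: "i \<in> {1..n} \<Longrightarrow> n \<ge> 2 \<Longrightarrow> prv n i \<noteq> i"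
  and nxt_neq: "i \<in> {1..n} \<Longrightarrow> n \<ge> 2 \<Longrightarrow> nxt n i \<noteq> i"
  by (auto simp: prv_def nxt_def)

lemma prv_nxt: "i \<in> {1..n} \<Longrightarrow> prv n (nxt n i) = i"
  and nxt_prv: "i \<in> {1..n} \<Longrightarrow> nxt n (prv n i) = i"
  by (auto simp: prv_def nxt_def)

lemma finite_states: "finite (states n)"
proof -
  have "(UNIV :: bit set) = {0, 1}" by auto
  then have "finite (UNIV :: bit set)" by (metis finite.emptyI finite.insertI)
  then show ?thesis unfolding states_def by (intro finite_PiE) auto
qed

lemma local_update_states: "i \<in> {1..n} \<Longrightarrow> y \<in> states n \<Longrightarrow> local_update r n i y \<in> states n"
  by (auto simp: states_def local_update_def PiE_def extensional_def)

lemma local_update_201_involution: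
  assumes "n \<ge> 2" "i \<in> {1..n}"
  shows "local_update rule201 n i (local_update rule201 n i y) = y"
  using prv_neq[OF assms(2,1)] nxt_neq[OF assms(2,1)]
  by (auto simp: local_update_def rule201_def fun_eq_iff)

lemma periodic_if_bij:
  assumes "finite S" "bij_betw f S S" "y \<in> S"
  shows "\<exists>k>0. (f ^^ k) y = y"
proof -
  have inS: "(f ^^ k) z \<in> S" if "z \<in> S" for k z
    using that assms(2) by (induction k) (auto simp: bij_betw_def)
  have inj: "inj_on (f ^^ k) S" for k
  proof (induction k)
    case (Suc k)
    show ?case
    proof (rule inj_onI)
      fix a b assume ab: "a \<in> S" "b \<in> S" "(f ^^ Suc k) a = (f ^^ Suc k) b"
      then have "f ((f ^^ k) a) = f ((f ^^ k) b)" by simp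
      then have "(f ^^ k) a = (f ^^ k) b"
        using assms(2) inS ab(1,2) by (meson bij_betw_def inj_onD)
      then show "a = b" using Suc ab(1,2) by (meson inj_onD)
    qed
  qed auto
  have "\<not> inj (\<lambda>k. (f ^^ k) y)"
  proof
    assume "inj (\<lambda>k. (f ^^ k) y)"
    moreover have "range (\<lambda>k. (f ^^ k) y) \<subseteq> S" using inS assms(3) by auto
    ultimately show False
      using assms(1) by (meson finite_imageD finite_subset infinite_UNIV_nat)
  qed
  then obtain a b where ab: "a < b" "(f ^^ a) y = (f ^^ b) y"
    unfolding inj_def by (metis linorder_neqE_nat)
  have "(f ^^ b) y = (f ^^ a) ((f ^^ (b - a)) y)"
    using ab(1) by (metis add_diff_inverse_nat comp_apply funpow_add less_imp_not_less)
  then have "(f ^^ (b - a)) y = y"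
    using ab(2) inj[of a] inS assms(3) by (metis inj_onD)
  then show ?thesis using ab(1) by (intro exI[of _ "b - a"]) auto
qed

lemma fold_bij:
  assumes "\<And>i. i \<in> set xs \<Longrightarrow> bij_betw (F i) S S"
  shows "bij_betw (fold F xs) S S"
  using assms
proof (induction xs)
  case (Cons x xs)
  then have "bij_betw (F x) S S" "bij_betw (fold F xs) S S" by auto
  moreover have "fold F (x # xs) = fold F xs \<circ> F x" by (simp add: fun_eq_iff)
  ultimately show ?case by (metis bij_betw_trans)
qed (auto simp: bij_betw_def)

lemma local_update_201_bij:
  assumes "n \<ge> 2" "i \<in> {1..n}"
  shows "bij_betw (local_update rule201 n i) (states n) (states n)"
  by (rule bij_betw_byWitness[where f' = "local_update rule201 n i"])
    (use assms local_update_201_involution local_update_states in auto)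

lemma periodic_states_wrt_201:
  assumes "n \<ge> 2" "simple_update_order n \<pi>"
  shows "periodic_states_wrt rule201 n \<pi> = states n"
proof -
  have "bij_betw (system_map rule201 n \<pi>) (states n) (states n)"
    unfolding system_map_def using assms
    by (intro fold_bij local_update_201_bij) (auto simp: simple_update_order_def)
  then show ?thesis
    using periodic_if_bij[OF finite_states] by (auto simp: periodic_states_wrt_def)
qed

lemma simple_update_order_upt: "simple_update_order n [1..<Suc n]"
  by (auto simp: simple_update_order_def)

lemma periodic_states_201: "n \<ge> 2 \<Longrightarrow> periodic_states rule201 n = states n"
  unfolding periodic_states_def by (intro periodic_states_wrt_201 simple_update_order_upt)

theorem periodic_states_201_independent:
  "n \<ge> 2 \<Longrightarrow> simple_update_order n \<pi> \<Longrightarrow>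
     periodic_states_wrt rule201 n \<pi> = periodic_states rule201 n"
  by (simp add: periodic_states_201 periodic_states_wrt_201)

definition triples :: "nat \<Rightarrow> state \<Rightarrow> nat set" where
  "triples n y = {i \<in> {1..n}. y (prv n i) = 1 \<and> y i = 1 \<and> y (nxt n i) = 1}"

definition triple_free :: "nat \<Rightarrow> state set" where
  "triple_free n = {y \<in> states n. triples n y = {}}"

lemma triples_local_update_73:
  assumes "n \<ge> 3" "i \<in> {1..n}"
  shows "triples n (local_update rule73 n i y) \<subseteq> triples n y - {i}"
proof
  fix j assume j: "j \<in> triples n (local_update rule73 n i y)"
  then have jn: "j \<in> {1..n}" by (auto simp: triples_def)
  have ne: "prv n i \<noteq> i" "nxt n i \<noteq> i" "prv n j \<noteq> j" "nxt n j \<noteq> j"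
    using prv_neq[OF assms(2)] nxt_neq[OF assms(2)] prv_neq[OF jn] nxt_neq[OF jn] assms(1) by simp_all
  have inv: "prv n (nxt n j) = j" "nxt n (prv n j) = j"
    using jn by (auto intro!: prv_nxt nxt_prv)
  show "j \<in> triples n y - {i}"
  proof (cases "j \<in> {i, prv n i, nxt n i} \<or> prv n j = i \<or> nxt n j = i")
    case False
    then show ?thesis using j by (auto simp: triples_def local_update_def)
  next
    case True
    then consider "j = i" | "prv n j = i" "j \<noteq> i" | "nxt n j = i" "j \<noteq> i"
      using assms(2) nxt_prv[OF assms(2)] prv_nxt[OF assms(2)] by auto
    then show ?thesis
      using j jn ne inv
      by cases (auto simp: triples_def local_update_def rule73_def split: if_splits)
  qed
qed

lemma triples_fold_73:
  assumes "n \<ge> 3" "set xs \<subseteq> {1..n}"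
  shows "triples n (fold (local_update rule73 n) xs y) \<subseteq> triples n y - set xs"
  using assms(2)
proof (induction xs arbitrary: y)
  case (Cons x xs)
  then show ?case
    using triples_local_update_73[OF assms(1), of x y] by fastforce
qed auto

lemma local_update_73_201:
  assumes "y \<in> triple_free n" "i \<in> {1..n}"
  shows "local_update rule73 n i y = local_update rule201 n i y"
  using assms
  by (auto simp: triple_free_def triples_def local_update_def rule73_def rule201_def fun_eq_iff)

lemma local_update_73_triple_free:
  assumes "n \<ge> 3" "i \<in> {1..n}" "y \<in> triple_free n"
  shows "local_update rule73 n i y \<in> triple_free n"
  using assms triples_local_update_73[OF assms(1,2), of y]
  by (auto simp: triple_free_def local_update_states)

lemma local_update_73_bij:
  assumes "n \<ge> 3" "i \<in> {1..n}"
  shows "bij_betw (local_update rule73 n i) (triple_free n) (triple_free n)"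
proof (rule bij_betw_byWitness[where f' = "local_update rule73 n i"])
  have "local_update rule73 n i (local_update rule73 n i y) = y" if "y \<in> triple_free n" for y
    using assms that local_update_73_201[OF _ assms(2)] local_update_73_triple_free[OF assms that]
      local_update_201_involution[OF _ assms(2)] by auto
  then show "\<forall>y\<in>triple_free n. local_update rule73 n i (local_update rule73 n i y) = y"
    and "\<forall>y\<in>triple_free n. local_update rule73 n i (local_update rule73 n i y) = y"
    by auto
qed (use assms local_update_73_triple_free in auto)

lemma periodic_states_wrt_73:
  assumes "n \<ge> 3" "simple_update_order n \<pi>"
  shows "periodic_states_wrt rule73 n \<pi> = triple_free n"
proof
  have "bij_betw (system_map rule73 n \<pi>) (triple_free n) (triple_free n)"
    unfolding system_map_def using assms
    by (intro fold_bij local_update_73_bij) (auto simp: simple_update_order_def)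
  moreover have "finite (triple_free n)"
    using finite_states by (auto simp: triple_free_def)
  ultimately show "triple_free n \<subseteq> periodic_states_wrt rule73 n \<pi>"
    using periodic_if_bij[of "triple_free n"]
    by (auto simp: periodic_states_wrt_def triple_free_def)
next
  have sub: "triples n (system_map rule73 n \<pi> y) = {}" for y
    using triples_fold_73[OF assms(1), of \<pi> y] assms(2)
    by (auto simp: simple_update_order_def system_map_def triples_def)
  show "periodic_states_wrt rule73 n \<pi> \<subseteq> triple_free n"
  proof
    fix y assume "y \<in> periodic_states_wrt rule73 n \<pi>"
    then obtain k where k: "k > 0" "(system_map rule73 n \<pi> ^^ k) y = y" "y \<in> states n"
      by (auto simp: periodic_states_wrt_def)
    then obtain k' where "k = Suc k'" by (cases k) auto
    then have "y = system_map rule73 n \<pi> ((system_map rule73 n \<pi> ^^ k') y)"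
      using k(2) by simp
    then have "triples n y = {}" using sub by metis
    then show "y \<in> triple_free n" using k(3) by (simp add: triple_free_def)
  qed
qed

lemma periodic_states_73: "n \<ge> 3 \<Longrightarrow> periodic_states rule73 n = triple_free n"
  unfolding periodic_states_def by (intro periodic_states_wrt_73 simple_update_order_upt)

theorem periodic_states_73_independent:
  "n \<ge> 3 \<Longrightarrow> simple_update_order n \<pi> \<Longrightarrow>
     periodic_states_wrt rule73 n \<pi> = periodic_states rule73 n"
  by (simp add: periodic_states_73 periodic_states_wrt_73)

text \<open>As \<^const>\<open>subgroup_generated\<close> ignores generators outside the carrier, the following two
  facts are what makes \<^const>\<open>dynamics_group\<close> the group generated by all local updates.\<close>

lemma local_update_201_in_BijGroup:
  assumes "n \<ge> 2" "i \<in> {1..n}"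
  shows "restrict (local_update rule201 n i) (periodic_states rule201 n)
           \<in> carrier (BijGroup (periodic_states rule201 n))"
  using local_update_201_bij[OF assms] assms
  by (auto simp: BijGroup_def Bij_def periodic_states_201 cong: bij_betw_cong)

lemma local_update_73_in_BijGroup:
  assumes "n \<ge> 3" "i \<in> {1..n}"
  shows "restrict (local_update rule73 n i) (periodic_states rule73 n)
           \<in> carrier (BijGroup (periodic_states rule73 n))"
  using local_update_73_bij[OF assms] assms
  by (auto simp: BijGroup_def Bij_def periodic_states_73 cong: bij_betw_cong)

end

theory Submission
  imports Defs
begin

text \<open>
  On states without three consecutive ones rule 73 acts exactly like rule 201, and these states are
  the periodic states of rule 73. So \<open>G\<^sub>7\<^sub>3\<close> is the image of \<open>G\<^sub>2\<^sub>0\<^sub>1\<close> under restriction to the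
  triple-free states, and two images of the same group are isomorphic as soon as both maps have the
  same fibres (\<open>iso_if_same_fibres\<close>). As all local updates are involutions, elements of
  \<open>G\<^sub>2\<^sub>0\<^sub>1\<close> are words in the updates. What has to be shown is therefore that two words agree on all
  triple-free states if and only if they agree on the orbit of the zero state and on the orbits of
  the zero blocks of length \<open>m\<close> with \<open>m = n - 2\<close> or \<open>3 \<le> m \<le> n - 5\<close>.

  Under rule 201 a one that has a neighbouring one is frozen: neither of the two can ever change.
  All other ones can be switched off, so the orbit of a state is determined by its frozen ones
  (\<open>in_orbit_of_frozen_part\<close>). Frozen ones also insulate: if an arc of the cycle is bounded by frozen
  ones, a word changes the values on the arc in a way that does not depend on the rest of the state
  (\<open>coupled_run\<close>). Hence the action on a state with frozen ones splits into the actions on its gaps,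
  the maximal arcs without frozen ones, and on a gap of length \<open>m\<close> it is the action on the orbit of
  the zero block of length \<open>m\<close> in the same place. Gaps with \<open>m \<le> 2\<close> carry no action, because each of
  their sites is next to a frozen one.

  It remains to see which lengths occur in triple-free states. There the frozen ones come in pairs
  \<open>11\<close>. Either both ends of the gap belong to the same pair, which gives \<open>m = n - 2\<close>, or the gap is
  bounded by two pairs with at least one further site between them, which gives \<open>m \<le> n - 5\<close>
  (\<open>gap_around\<close>). Conversely, each of these lengths is realised by putting a pair at either end of
  the arc and zeros elsewhere (\<open>triple_free_agree_on_fibonacci_orbits\<close>). A state without any
  frozen one lies in the orbit of the zero state.
\<close>


section \<open>Groups generated by involutions, and isomorphic images\<close>

text \<open>Sending \<open>f x\<close> to \<open>p x\<close> is well defined and injective by the condition on the fibres.\<close>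

lemma iso_if_same_fibres:
  assumes G: "group G"
    and f: "f \<in> hom G A" "f ` carrier G = carrier A"
    and p: "p \<in> hom G B" "p ` carrier G = carrier B"
    and fibres: "\<And>x y. x \<in> carrier G \<Longrightarrow> y \<in> carrier G \<Longrightarrow> f x = f y \<longleftrightarrow> p x = p y"
  shows "A \<cong> B"
proof -
  interpret group G by (fact G)
  define q where "q a = p (inv_into (carrier G) f a)" for a
  have q: "q (f x) = p x" if "x \<in> carrier G" for x
  proof -
    have "inv_into (carrier G) f (f x) \<in> carrier G" "f (inv_into (carrier G) f (f x)) = f x"
      using that by (simp_all add: inv_into_into f_inv_into_f)
    then show ?thesis unfolding q_def using fibres that by blast
  qed
  have "q \<in> hom A B"
  proof (rule homI)
    fix a assume "a \<in> carrier A"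
    then show "q a \<in> carrier B" unfolding f(2)[symmetric] p(2)[symmetric] using q by auto
  next
    fix a b assume "a \<in> carrier A" "b \<in> carrier A"
    then obtain x y where xy: "x \<in> carrier G" "y \<in> carrier G" "a = f x" "b = f y"
      unfolding f(2)[symmetric] by blast
    then have "a \<otimes>\<^bsub>A\<^esub> b = f (x \<otimes>\<^bsub>G\<^esub> y)" using hom_mult[OF f(1)] by simp
    then show "q (a \<otimes>\<^bsub>A\<^esub> b) = q a \<otimes>\<^bsub>B\<^esub> q b"
      using xy q hom_mult[OF p(1)] by simp
  qed
  moreover have "bij_betw q (carrier A) (carrier B)"
    unfolding bij_betw_def
  proof
    show "inj_on q (carrier A)"
      using q fibres by (auto simp: f(2)[symmetric] intro!: inj_onI)
    show "q ` carrier A = carrier B"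
      using q by (simp add: f(2)[symmetric] p(2)[symmetric] image_image)
  qed
  ultimately show ?thesis by (auto simp: is_iso_def iso_def)
qed

lemma fold_closed:
  assumes "\<And>i x. i \<in> I \<Longrightarrow> x \<in> P \<Longrightarrow> F i x \<in> P" "set xs \<subseteq> I" "x \<in> P"
  shows "fold F xs x \<in> P"
  using assms(2,3) by (induction xs arbitrary: x) (auto simp: assms(1))

lemma restrict_fold_in_Bij:
  assumes "\<And>i x. i \<in> I \<Longrightarrow> x \<in> P \<Longrightarrow> F i x \<in> P"
    and "\<And>i x. i \<in> I \<Longrightarrow> x \<in> P \<Longrightarrow> F i (F i x) = x"
    and "set xs \<subseteq> I"
  shows "restrict (fold F xs) P \<in> Bij P"
proof -
  have "bij_betw (F i) P P" if "i \<in> set xs" for i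
    using assms that by (intro bij_betw_byWitness[where f' = "F i"]) blast+
  then have "bij_betw (fold F xs) P P" by (rule fold_bij)
  then show ?thesis by (auto simp: Bij_def cong: bij_betw_cong)
qed

lemma compose_restrict_fold:
  assumes "\<And>i x. i \<in> I \<Longrightarrow> x \<in> P \<Longrightarrow> F i x \<in> P" "set ys \<subseteq> I"
  shows "compose P (restrict (fold F xs) P) (restrict (fold F ys) P)
           = restrict (fold F (ys @ xs)) P"
  using fold_closed[OF assms] by (auto simp: compose_def fun_eq_iff)

text \<open>Involutions are their own inverses, so words in the generators already form a group.\<close>

lemma carrier_generated_by_involutions:
  assumes cl: "\<And>i x. i \<in> I \<Longrightarrow> x \<in> P \<Longrightarrow> F i x \<in> P"
    and inv: "\<And>i x. i \<in> I \<Longrightarrow> x \<in> P \<Longrightarrow> F i (F i x) = x"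
  shows "carrier (subgroup_generated (BijGroup P) ((\<lambda>i. restrict (F i) P) ` I))
           = {restrict (fold F xs) P | xs. set xs \<subseteq> I}" (is "carrier ?G = ?W")
proof -
  interpret group "BijGroup P" by (rule group_BijGroup)
  have single: "restrict (F i) P = restrict (fold F [i]) P" for i by simp
  have bij: "restrict (fold F xs) P \<in> Bij P" if "set xs \<subseteq> I" for xs
    using cl inv that by (rule restrict_fold_in_Bij)
  have mult: "restrict (fold F xs) P \<otimes>\<^bsub>BijGroup P\<^esub> restrict (fold F ys) P
      = restrict (fold F (ys @ xs)) P" if "set xs \<subseteq> I" "set ys \<subseteq> I" for xs ys
    using bij that compose_restrict_fold[OF cl that(2)] by (simp add: BijGroup_def)
  have gens: "restrict (F i) P \<in> carrier (BijGroup P)" if "i \<in> I" for i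
    using bij[of "[i]"] that by (simp add: BijGroup_def)
  have one_word: "\<one>\<^bsub>BijGroup P\<^esub> = restrict (fold F []) P"
    by (simp add: BijGroup_def restrict_def id_def)
  have inv_gen: "inv\<^bsub>BijGroup P\<^esub> (restrict (F i) P) = restrict (F i) P" if "i \<in> I" for i
  proof (rule inv_equality)
    show "restrict (F i) P \<otimes>\<^bsub>BijGroup P\<^esub> restrict (F i) P = \<one>\<^bsub>BijGroup P\<^esub>"
      using mult[of "[i]" "[i]"] that inv unfolding one_word by (auto simp: fun_eq_iff)
  qed (use gens that in auto)
  have carr: "carrier ?G = generate (BijGroup P) ((\<lambda>i. restrict (F i) P) ` I)"
    using gens by (auto simp: carrier_subgroup_generated intro!: arg_cong2[where f = generate])
  show ?thesis
  proof
    show "carrier ?G \<subseteq> ?W"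
    proof
      fix g assume "g \<in> carrier ?G"
      then show "g \<in> ?W" unfolding carr
      proof (induction rule: generate.induct)
        case one
        show ?case unfolding one_word by (intro CollectI exI[of _ "[]"] conjI refl) simp
      next
        case (incl h)
        then obtain i where "i \<in> I" "h = restrict (F i) P" by auto
        then show ?case by (intro CollectI exI[of _ "[i]"]) simp
      next
        case (inv h)
        then obtain i where "i \<in> I" "h = restrict (F i) P" by auto
        then show ?case using inv_gen by (intro CollectI exI[of _ "[i]"]) simp
      next
        case (eng g h)
        then obtain xs ys where "set xs \<subseteq> I" "set ys \<subseteq> I"
          "g = restrict (fold F xs) P" "h = restrict (fold F ys) P" by blast
        then show ?case using mult by (intro CollectI exI[of _ "ys @ xs"]) auto
      qed
    qed
    have "restrict (fold F xs) P \<in> carrier ?G" if "set xs \<subseteq> I" for xs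
      using that
    proof (induction xs rule: rev_induct)
      case Nil
      show ?case unfolding carr one_word[symmetric] by (rule generate.one)
    next
      case (snoc i xs)
      have "restrict (fold F xs) P \<in> carrier ?G"
        by (rule snoc.IH) (use snoc.prems in auto)
      then have "restrict (F i) P \<otimes>\<^bsub>BijGroup P\<^esub> restrict (fold F xs) P \<in> carrier ?G"
        unfolding carr
        by (rule generate.eng[OF generate.incl, rotated]) (use snoc.prems in auto)
      moreover have "restrict (fold F [i]) P \<otimes>\<^bsub>BijGroup P\<^esub> restrict (fold F xs) P
          = restrict (fold F (xs @ [i])) P"
        by (rule mult) (use snoc.prems in auto)
      ultimately show ?case by (simp only: single)
    qed
    then show "?W \<subseteq> carrier ?G" by auto
  qed
qed


section \<open>Words of local updates\<close>

text \<open>On triple-free states the updates of both rules coincide, so words in the updates of rule 201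
  describe both dynamics groups.\<close>

definition run :: "nat \<Rightarrow> nat list \<Rightarrow> state \<Rightarrow> state" where
  "run n xs = fold (local_update rule201 n) xs"

lemma run_simps [simp]:
  "run n [] y = y"
  "run n (i # xs) y = run n xs (local_update rule201 n i y)"
  "run n (xs @ ys) y = run n ys (run n xs y)"
  by (simp_all add: run_def)

lemma run_states: "set xs \<subseteq> {1..n} \<Longrightarrow> y \<in> states n \<Longrightarrow> run n xs y \<in> states n"
  unfolding run_def by (rule fold_closed[OF local_update_states])

lemma carrier_dynamics_group_201:
  assumes "n \<ge> 2"
  shows "carrier (dynamics_group rule201 n)
           = {restrict (run n xs) (states n) | xs. set xs \<subseteq> {1..n}}"
  unfolding dynamics_group_def periodic_states_201[OF assms] run_def
  by (rule carrier_generated_by_involutions)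
    (auto simp: local_update_states local_update_201_involution[OF assms])

lemma local_update_201_triple_free:
  assumes "n \<ge> 3" "i \<in> {1..n}" "y \<in> triple_free n"
  shows "local_update rule201 n i y \<in> triple_free n"
  using local_update_73_triple_free[OF assms] local_update_73_201[OF assms(3,2)] by simp

lemma run_triple_free:
  "n \<ge> 3 \<Longrightarrow> set xs \<subseteq> {1..n} \<Longrightarrow> y \<in> triple_free n \<Longrightarrow> run n xs y \<in> triple_free n"
  unfolding run_def by (rule fold_closed[OF local_update_201_triple_free])

lemma carrier_dynamics_group_73:
  assumes "n \<ge> 3"
  shows "carrier (dynamics_group rule73 n)
           = {restrict (run n xs) (triple_free n) | xs. set xs \<subseteq> {1..n}}"
proof -
  have "(\<lambda>i. restrict (local_update rule73 n i) (triple_free n)) ` {1..n}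
      = (\<lambda>i. restrict (local_update rule201 n i) (triple_free n)) ` {1..n}"
    using local_update_73_201 by (intro image_cong restrict_ext) auto
  then show ?thesis
    unfolding dynamics_group_def periodic_states_73[OF assms] run_def
    using assms
    by (simp only:, intro carrier_generated_by_involutions)
      (auto simp: local_update_201_triple_free local_update_201_involution)
qed

lemma group_dynamics_group: "group (dynamics_group r n)"
  unfolding dynamics_group_def
  by (intro group.group_subgroup_generated group_BijGroup)

lemma orbit201_eq:
  assumes "n \<ge> 2" "y \<in> states n"
  shows "orbit201 n y = {run n xs y | xs. set xs \<subseteq> {1..n}}"
proof -
  have "orbit201 n y = (\<lambda>g. g y) ` carrier (dynamics_group rule201 n)"
    by (auto simp: orbit201_def orbit_def)
  also have "\<dots> = {run n xs y | xs. set xs \<subseteq> {1..n}}"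
    unfolding carrier_dynamics_group_201[OF assms(1)] using assms(2)
    by (simp add: setcompr_eq_image image_image)
  finally show ?thesis .
qed

lemma orbit201_subset_states:
  assumes "n \<ge> 2" "y \<in> states n"
  shows "orbit201 n y \<subseteq> states n"
  using run_states assms(2) by (auto simp: orbit201_eq[OF assms])

lemma orbit201_closed:
  assumes "n \<ge> 2" "y \<in> states n" "i \<in> {1..n}" "z \<in> orbit201 n y"
  shows "local_update rule201 n i z \<in> orbit201 n y"
proof -
  obtain xs where "set xs \<subseteq> {1..n}" "z = run n xs y"
    using assms(4) by (auto simp: orbit201_eq[OF assms(1,2)])
  then show ?thesis
    using assms(3) unfolding orbit201_eq[OF assms(1,2)]
    by (intro CollectI exI[of _ "xs @ [i]"]) auto
qed

lemma zero_state_states: "zero_state n \<in> states n"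
  by (simp add: zero_state_def states_def)

lemma zero_block_state_states: "zero_block_state n m l \<in> states n"
  by (simp add: zero_block_state_def states_def)


section \<open>Frozen sites and locality\<close>

text \<open>Two adjacent ones block each other, so being frozen is preserved by all updates.\<close>

definition frozen :: "nat \<Rightarrow> state \<Rightarrow> nat \<Rightarrow> bool" where
  "frozen n y i \<longleftrightarrow> y i = 1 \<and> (y (prv n i) = 1 \<or> y (nxt n i) = 1)"

lemma local_update_next_to_one:
  assumes "y (prv n i) = 1 \<or> y (nxt n i) = 1"
  shows "local_update rule201 n k y i = y i"
  using assms by (auto simp: local_update_def rule201_def)

lemma frozen_local_update:
  assumes "i \<in> {1..n}" "frozen n y i"
  shows "frozen n (local_update rule201 n k y) i"
proof -
  have i: "local_update rule201 n k y i = 1"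
    using assms(2) local_update_next_to_one[of y n i k] by (auto simp: frozen_def)
  have "local_update rule201 n k y (prv n i) = y (prv n i)"
    "local_update rule201 n k y (nxt n i) = y (nxt n i)"
    using assms local_update_next_to_one[of y n _ k]
    by (auto simp: frozen_def prv_nxt nxt_prv)
  then show ?thesis using i assms(2) by (auto simp: frozen_def)
qed

text \<open>A frozen site itself falls under this lemma, as its partner is frozen too.\<close>

lemma run_next_to_frozen:
  assumes "i \<in> {1..n}" "frozen n y (prv n i) \<or> frozen n y (nxt n i)"
  shows "run n xs y i = y i"
  using assms(2)
proof (induction xs arbitrary: y)
  case (Cons k xs)
  then have "frozen n (local_update rule201 n k y) (prv n i) \<or>
      frozen n (local_update rule201 n k y) (nxt n i)"
    using frozen_local_update prv_mem nxt_mem assms(1) by metis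
  then have "run n (k # xs) y i = local_update rule201 n k y i" using Cons.IH by simp
  also have "\<dots> = y i"
    using Cons.prems by (intro local_update_next_to_one) (auto simp: frozen_def)
  finally show ?case .
qed simp

text \<open>The invariant that makes the dynamics on \<open>A\<close> independent of the outside: the two states
  agree on \<open>A\<close>, and all sites bordering \<open>A\<close> are frozen in both of them, hence carry a one forever.
  Updates in \<open>A\<close> then see the same neighbours in both states, and updates outside of \<open>A\<close> cannot
  thaw the border.\<close>

definition coupled :: "nat \<Rightarrow> nat set \<Rightarrow> state \<Rightarrow> state \<Rightarrow> bool" where
  "coupled n A y z \<longleftrightarrow> (\<forall>i\<in>A. y i = z i \<and>
     (\<forall>j\<in>{prv n i, nxt n i} - A. frozen n y j \<and> frozen n z j))"

lemma coupled_local_update: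
  assumes "A \<subseteq> {1..n}" "coupled n A y z"
  shows "coupled n A (local_update rule201 n k y) (local_update rule201 n k z)"
  unfolding coupled_def
proof (intro ballI conjI)
  fix i assume i: "i \<in> A"
  have nb: "y j = z j" if "j \<in> {prv n i, nxt n i}" for j
    using assms(2) i that by (cases "j \<in> A") (auto simp: coupled_def frozen_def)
  have "y i = z i" using assms(2) i by (auto simp: coupled_def)
  then show "local_update rule201 n k y i = local_update rule201 n k z i"
    using nb by (cases "k = i") (auto simp: local_update_def)
  fix j assume j: "j \<in> {prv n i, nxt n i} - A"
  have "j \<in> {1..n}" using i j assms(1) prv_mem nxt_mem by blast
  moreover have "frozen n y j" "frozen n z j" using assms(2) i j unfolding coupled_def by blast+
  ultimately show "frozen n (local_update rule201 n k y) j" "frozen n (local_update rule201 n k z) j"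
    by (auto intro: frozen_local_update)
qed

lemma coupled_run:
  assumes "A \<subseteq> {1..n}" "coupled n A y z"
  shows "coupled n A (run n xs y) (run n xs z)"
  using assms(2)
  by (induction xs arbitrary: y z) (auto intro: coupled_local_update[OF assms(1)])

text \<open>A one that is not frozen has two zero neighbours, so its update switches it off; this freezes
  and thaws nothing. Switching off all of these ones leaves just the frozen ones, and the steps can
  be undone because updates are involutions.\<close>

lemma in_orbit_of_frozen_part:
  assumes "n \<ge> 2" "y \<in> states n"
  shows "y \<in> orbit201 n (\<lambda>i\<in>{1..n}. if frozen n y i then 1 else 0)"
  using assms(2)
proof (induction "card {i\<in>{1..n}. y i = 1 \<and> \<not> frozen n y i}" arbitrary: y rule: less_induct)
  case less
  let ?M = "\<lambda>y. {i\<in>{1..n}. y i = 1 \<and> \<not> frozen n y i}"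
  let ?c = "\<lambda>y. (\<lambda>i\<in>{1..n}. if frozen n y i then 1 else 0) :: state"
  have c: "?c y \<in> states n" for y by (simp add: states_def)
  show ?case
  proof (cases "?M y = {}")
    case True
    have "?c y i = y i" for i
    proof (cases "i \<in> {1..n}")
      case True
      then show ?thesis using \<open>?M y = {}\<close> by (cases "y i = 1") (auto simp: frozen_def)
    next
      case False
      then show ?thesis using less.prems by (auto simp: states_def PiE_def extensional_def)
    qed
    then have "?c y = y" by blast
    moreover have "y \<in> orbit201 n y"
      unfolding orbit201_eq[OF assms(1) less.prems] by (intro CollectI exI[of _ "[]"]) simp
    ultimately show ?thesis by simp
  next
    case False
    then obtain i where i: "i \<in> {1..n}" "y i = 1" "\<not> frozen n y i" by blast
    define y' where "y' = local_update rule201 n i y"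
    have y': "y' = y(i := 0)"
      using i by (auto simp: y'_def local_update_def rule201_def frozen_def)
    have fr: "frozen n y' j \<longleftrightarrow> frozen n y j" if "j \<in> {1..n}" for j
    proof
      show "frozen n y j" if "frozen n y' j"
        using that by (auto simp: frozen_def y' split: if_splits)
      show "frozen n y' j" if "frozen n y j"
        unfolding y'_def using \<open>j \<in> {1..n}\<close> that by (rule frozen_local_update)
    qed
    have "?M y' \<subset> ?M y" using i fr by (auto simp: y' split: if_splits)
    then have "card (?M y') < card (?M y)" by (intro psubset_card_mono) auto
    moreover have "y' \<in> states n"
      unfolding y'_def using i(1) less.prems by (rule local_update_states)
    moreover have "?c y' = ?c y" using fr by (intro restrict_ext) simp
    ultimately have "y' \<in> orbit201 n (?c y)" using less.hyps[of y'] by simp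
    then have "local_update rule201 n i y' \<in> orbit201 n (?c y)"
      using orbit201_closed[OF assms(1) c i(1)] by blast
    then show ?thesis
      using local_update_201_involution[OF assms(1) i(1)] by (simp add: y'_def)
  qed
qed


section \<open>Arcs of the cycle\<close>

text \<open>The periodic enumeration of the vertices by \<open>j mod n\<close>, with residue \<open>0\<close> represented by \<open>n\<close>.
  Arcs of the cycle become intervals of natural numbers inside a window \<open>{s<..s + n}\<close>, on which the
  enumeration is bijective.\<close>

definition site :: "nat \<Rightarrow> nat \<Rightarrow> nat" where
  "site n j = (if j mod n = 0 then n else j mod n)"

lemma site_mem: "n > 0 \<Longrightarrow> site n j \<in> {1..n}"
  by (auto simp: site_def Suc_le_eq less_imp_le)

lemma site_mod [simp]: "site n j mod n = j mod n"
  by (simp add: site_def)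

lemma site_id: "i \<in> {1..n} \<Longrightarrow> site n i = i"
  by (cases "i = n") (auto simp: site_def)

lemma site_eq_iff: "site n i = site n j \<longleftrightarrow> i mod n = j mod n"
  by (metis site_mod site_def)

lemma site_add_n [simp]: "site n (j + n) = site n j"
  by (simp add: site_eq_iff)

lemma nxt_site: "n \<ge> 2 \<Longrightarrow> nxt n (site n j) = site n (Suc j)"
  using mod_less_divisor[of n j] by (auto simp: nxt_def site_def mod_Suc simp del: mod_less_divisor)

lemma prv_site: "n \<ge> 2 \<Longrightarrow> prv n (site n (Suc j)) = site n j"
  using prv_nxt[OF site_mem, of n j] nxt_site[of n j] by simp

lemma site_inj:
  assumes "i \<in> {s<..s + n}" "j \<in> {s<..s + n}" "site n i = site n j"
  shows "i = j"
proof -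
  have "a = b" if "a \<le> b" "b < a + n" "a mod n = b mod n" for a b :: nat
  proof -
    have "n dvd b - a" using that(1,3) mod_eq_dvd_iff_nat by metis
    moreover have "b - a < n" using that(1,2) by linarith
    ultimately have "b - a = 0" using nat_dvd_not_less by blast
    then show ?thesis using that(1) by simp
  qed
  from this[of i j] this[of j i] show ?thesis
    using assms by (cases "i \<le> j") (auto simp: site_eq_iff)
qed

lemma site_surj:
  assumes "i \<in> {1..n}"
  obtains j where "j \<in> {s<..s + n}" "i = site n j"
proof -
  have "\<exists>j\<in>{s<..s + n}. i = site n j"
  proof (induction s)
    case 0
    show ?case using assms site_id[OF assms] by (intro bexI[of _ i]) auto
  next
    case (Suc s)
    then obtain j where j: "j \<in> {s<..s + n}" "i = site n j" by blast
    show ?case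
    proof (cases "j = Suc s")
      case True
      then show ?thesis using j assms by (intro bexI[of _ "j + n"]) (auto simp del: add_Suc)
    next
      case False
      then show ?thesis using j by (intro bexI[of _ j]) auto
    qed
  qed
  then show thesis using that by blast
qed

lemma site_in_image:
  assumes "j \<in> {s<..s + n}" "J \<subseteq> {s<..s + n}"
  shows "site n j \<in> site n ` J \<longleftrightarrow> j \<in> J"
  using site_inj[OF assms(1)] assms(2) by blast

lemma zero_block_state_site:
  assumes "m \<le> n" "j \<in> {s<..s + n}"
  shows "zero_block_state n m (site n (Suc s)) (site n j) = (if j \<le> s + m then 0 else 1)"
proof -
  have "(\<exists>k<m. site n j mod n = (site n (Suc s) + k) mod n)
      \<longleftrightarrow> (\<exists>k<m. site n j = site n (Suc s + k))"
    by (simp add: site_eq_iff mod_add_left_eq[of "site n (Suc s)" n, symmetric] mod_add_left_eq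
        del: add_Suc)
  also have "\<dots> \<longleftrightarrow> (\<exists>k<m. j = Suc s + k)"
    using site_inj[OF assms(2), of "Suc s + _"] assms by auto
  also have "\<dots> \<longleftrightarrow> j \<le> s + m"
    using assms(2) by (auto intro!: exI[of _ "j - Suc s"])
  finally show ?thesis
    using site_mem[of n j] assms by (auto simp: zero_block_state_def)
qed

text \<open>The gap containing a site \<open>i\<close> that is not next to a frozen one, bounded by the frozen positions
  \<open>s\<close> and \<open>s + m + 1\<close>. As the two sites on either side of \<open>i\<close> are not frozen either and so belong
  to the gap, \<open>m \<ge> 3\<close>. The upper bounds come from the partners of the two frozen ends, which lie
  outside of the gap: if these two pairs do not coincide, then they can neither overlap nor be
  adjacent without creating three consecutive ones.\<close>

lemma gap_around:
  assumes n: "n > 3" and y: "y \<in> triple_free n" and i: "i \<in> {1..n}"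
    and f: "f \<in> {1..n}" "frozen n y f"
    and free: "\<not> frozen n y (prv n i)" "\<not> frozen n y (nxt n i)"
  obtains s m where "m \<in> {3..n - 5} \<union> {n - 2}"
    "frozen n y (site n s)" "frozen n y (site n (Suc (s + m)))"
    "\<And>j. j \<in> {s<..s + m} \<Longrightarrow> \<not> frozen n y (site n j)" "i \<in> site n ` {s<..s + m}"
proof -
  define P where "P j = frozen n y (site n j)" for j
  have per: "P (j + n) = P j" for j by (simp add: P_def)
  have nb: "P j \<or> P (Suc (Suc j))" if "P (Suc j)" for j
    using that n by (auto simp: P_def frozen_def prv_site nxt_site)
  have no3: False if "P j" "P (Suc j)" "P (Suc (Suc j))" for j
  proof -
    have "site n (Suc j) \<in> triples n y"
      using that n site_mem[of n "Suc j"]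
      by (auto simp: P_def frozen_def triples_def prv_site nxt_site)
    then show False using y by (auto simp: triple_free_def)
  qed
  obtain p where p: "i = Suc p" using i by (cases i) auto
  have Pi1: "\<not> P p" "\<not> P (Suc (Suc p))"
    using free i n prv_site[of n p] nxt_site[of n i] site_id[OF i] by (auto simp: P_def p)
  then have Pi: "\<not> P (Suc p)" using nb by blast
  have Pc: "\<not> P (p + n)" "\<not> P (Suc (p + n))" "\<not> P (Suc (Suc (p + n)))"
    using Pi Pi1 per[of p] per[of "Suc p"] per[of "Suc (Suc p)"] by auto
  \<comment> \<open>The gap is searched around position \<open>i + n\<close> rather than \<open>i\<close>, so that its left end is still a
    natural number.\<close>
  define S where "S = {j. j < p + n \<and> P j}"
  obtain j0 where "j0 \<in> {p + 2<..p + 2 + n}" "f = site n j0" using site_surj[OF f(1)] by blast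
  then have j0: "P j0" "p + 2 < j0" "j0 \<le> p + 2 + n" using f(2) by (auto simp: P_def)
  then have "j0 \<noteq> p + n" "j0 \<noteq> p + n + 1" "j0 \<noteq> p + n + 2" using Pc by auto
  then have "j0 \<in> S" using j0 by (auto simp: S_def)
  have finS: "finite S" by (simp add: S_def)
  define s where "s = Max S"
  have s: "s \<in> S" "j0 \<le> s"
    using Max_in[OF finS] Max_ge[OF finS] \<open>j0 \<in> S\<close> by (auto simp: s_def)
  then have s': "P s" "p + 2 < s" "s < p + n" using j0 by (auto simp: S_def)
  have smax: "\<not> P j" if "s < j" "j < p + n" for j
    using that Max_ge[OF finS, of j] by (auto simp: s_def[symmetric]) (auto simp: S_def)
  define t where "t = (LEAST t. p + n < t \<and> P t)"
  have t: "p + n < t" "P t"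
    using LeastI[of "\<lambda>t. p + n < t \<and> P t" "s + n"] s' per[of s] by (auto simp: t_def)
  have tmin: "\<not> P j" if "p + n < j" "j < t" for j
    using that not_less_Least[of j "\<lambda>t. p + n < t \<and> P t"] by (auto simp: t_def)
  have gap: "\<not> P j" if "s < j" "j < t" for j
    using that smax tmin Pc by (metis linorder_neqE_nat)
  have t3: "t \<ge> p + n + 3"
  proof -
    have "t \<noteq> p + n + 1" "t \<noteq> p + n + 2" using t(2) Pc by auto
    then show ?thesis using t(1) by linarith
  qed
  \<comment> \<open>The partners of the ends \<open>s\<close> and \<open>t\<close> are \<open>r = s - 1\<close> and \<open>t + 1\<close>.\<close>
  obtain r where r: "s = Suc r" using s'(2) by (cases s) auto
  have "\<not> P (Suc s)" using gap s' t3 by auto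
  then have Pr: "P r" using nb[of r] s' r by auto
  have t_le: "t \<le> r + n"
    unfolding t_def using Pr per[of r] s' r n by (intro Least_le) auto
  obtain q where q: "t = Suc q" using t(1) by (cases t) auto
  have "\<not> P q" using gap[of q] q s' t3 by auto
  then have Pt: "P (Suc t)" using nb[of q] t(2) q by auto
  \<comment> \<open>One turn further, the left pair occupies \<open>r + n\<close> and \<open>r + n + 1\<close>.\<close>
  have "t + 1 \<noteq> r + n"
    using no3[of t] t(2) Pt per[of s] s'(1) r by auto
  moreover have "t + 2 \<noteq> r + n"
    using no3[of t] t(2) Pt per[of r] Pr by auto
  ultimately have cases: "t = r + n \<or> t + 3 \<le> r + n" using t_le by linarith
  show thesis
  proof (rule that[of "t - s - 1" s])
    show "t - s - 1 \<in> {3..n - 5} \<union> {n - 2}" using cases s' t3 r n by auto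
    show "frozen n y (site n s)" using s' by (simp add: P_def)
    show "frozen n y (site n (Suc (s + (t - s - 1))))" using t s' by (simp add: P_def)
    show "\<not> frozen n y (site n j)" if "j \<in> {s<..s + (t - s - 1)}" for j
    proof -
      have "s < j" "j < t" using that s' t by auto
      then show ?thesis using gap by (simp add: P_def)
    qed
    show "i \<in> site n ` {s<..s + (t - s - 1)}"
    proof (rule image_eqI)
      show "i = site n (i + n)" by (simp add: site_id[OF i])
      show "i + n \<in> {s<..s + (t - s - 1)}" using s' t3 p by auto
    qed
  qed
qed


section \<open>Agreement on triple-free states and on orbits\<close>

lemma neighbour_of_arc:
  assumes "n \<ge> 2" "i \<in> site n ` {s<..s + m}" "j \<in> {prv n i, nxt n i} - site n ` {s<..s + m}"
  shows "j = site n s \<or> j = site n (Suc (s + m))"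
proof -
  obtain k where k: "s < k" "k \<le> s + m" "i = site n k" using assms(2) by auto
  then obtain k' where k': "k = Suc k'" by (cases k) auto
  have "j = site n k' \<or> j = site n (Suc k)"
    using assms(1,3) k k' by (auto simp: prv_site nxt_site)
  then show ?thesis
  proof
    assume "j = site n k'"
    moreover from this have "k' \<notin> {s<..s + m}" using assms(3) by blast
    ultimately show ?thesis using k k' by (auto simp: less_Suc_eq)
  next
    assume "j = site n (Suc k)"
    moreover from this have "Suc k \<notin> {s<..s + m}" using assms(3) by blast
    ultimately show ?thesis using k by (auto simp: le_Suc_eq not_le less_Suc_eq)
  qed
qed

text \<open>Every zero block of an admitted length is coupled, on the block, to a triple-free state \<open>w\<close> that
  has a pair of ones at either end of the block and zeros elsewhere. Coupling persists along the
  orbit, and outside of the block nothing moves.\<close>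

lemma triple_free_agree_on_fibonacci_orbits:
  assumes n: "n > 3" and m: "m \<in> {3..n - 5} \<union> {n - 2}" and l: "l \<in> {1..n}"
    and xs: "set xs \<subseteq> {1..n}" and ys: "set ys \<subseteq> {1..n}"
    and agree: "\<And>y. y \<in> triple_free n \<Longrightarrow> run n xs y = run n ys y"
    and z: "z \<in> fibonacci_orbit n m l"
  shows "run n xs z = run n ys z"
proof -
  obtain s where s: "l = Suc s" using l by (cases l) auto
  have l_site: "site n (Suc s) = l" using site_id[OF l] s by simp
  have mn: "1 \<le> m" "m + 2 \<le> n" "m + 5 \<le> n \<or> m = n - 2" using m n by auto
  define zb where "zb = zero_block_state n m l"
  have zb: "zb (site n j) = (if j \<le> s + m then 0 else 1)" if "j \<in> {s<..s + n}" for j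
    unfolding zb_def l_site[symmetric] using zero_block_state_site that mn by simp
  \<comment> \<open>The two pairs of \<open>w\<close>; for \<open>m = n - 2\<close> they coincide.\<close>
  define J where "J = {s + m + 1, s + m + 2, s + n - 1, s + n}"
  have J: "J \<subseteq> {s<..s + n}" using mn by (auto simp: J_def)
  define w where "w = (\<lambda>i\<in>{1..n}. if i \<in> site n ` J then 1 else 0 :: bit)"
  have w: "w (site n j) = (if j \<in> J then 1 else 0)" if "j \<in> {s<..s + n}" for j
    using site_in_image[OF that J] site_mem[of n j] n by (simp add: w_def)
  define A where "A = site n ` {s<..s + m}"
  have A: "A \<subseteq> {1..n}" using site_mem n by (auto simp: A_def)
  have wrap: "site n (Suc (s + n)) = site n (Suc s)"
    using site_add_n[of n "Suc s"] by simp
  have zb_frozen: "frozen n zb (site n j)" if j: "j \<in> {s + m<..s + n}" for j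
  proof -
    obtain k where k: "j = Suc k" using j by (cases j) auto
    show ?thesis
    proof (cases "j = s + n")
      case True
      then have "zb (site n k) = 1" using zb[of k] k mn n by auto
      then have "zb (prv n (site n j)) = 1" using n by (simp add: k prv_site)
      then show ?thesis using zb[of j] j by (simp add: frozen_def)
    next
      case False
      then show ?thesis
        using zb[of j] zb[of "Suc j"] j mn n by (auto simp: frozen_def nxt_site)
    qed
  qed
  have zb_ends: "frozen n zb (site n s)" "frozen n zb (site n (Suc (s + m)))"
    using zb_frozen[of "s + n"] zb_frozen[of "Suc (s + m)"] mn n by auto
  have w_ends: "frozen n w (site n s)" "frozen n w (site n (Suc (s + m)))"
  proof -
    have "frozen n w (site n (Suc (s + n - 1)))"
      unfolding frozen_def using n mn w[of "s + n"] w[of "s + n - 1"]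
      by (subst prv_site) (auto simp: J_def)
    then show "frozen n w (site n s)" using n by simp
    show "frozen n w (site n (Suc (s + m)))"
      unfolding frozen_def using n mn w[of "Suc (s + m)"] w[of "Suc (Suc (s + m))"]
      by (auto simp: J_def nxt_site)
  qed
  have "coupled n A zb w"
    unfolding coupled_def
  proof (intro ballI conjI)
    fix i assume i: "i \<in> A"
    then show "zb i = w i" using zb w mn by (auto simp: A_def J_def)
    fix j assume "j \<in> {prv n i, nxt n i} - A"
    then have "j = site n s \<or> j = site n (Suc (s + m))"
      using neighbour_of_arc[of n i s m j] i n by (simp add: A_def)
    then show "frozen n zb j" "frozen n w j"
      using zb_ends w_ends by auto
  qed
  have w_tf: "w \<in> triple_free n"
  proof -
    have "\<not> (w (prv n i) = 1 \<and> w i = 1 \<and> w (nxt n i) = 1)" if "i \<in> {1..n}" for i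
    proof -
      obtain j where j: "j \<in> {s<..s + n}" "i = site n j" using site_surj[OF \<open>i \<in> {1..n}\<close>] .
      then obtain k where k: "j = Suc k" by (cases j) auto
      have nbs: "prv n i = site n k" "nxt n i = site n (Suc j)"
        using j k n by (auto simp: prv_site nxt_site)
      consider "j = s + n" | "j = Suc s" | "j < s + n" "s < k" using j k by fastforce
      then show ?thesis
      proof cases
        assume "j = s + n"
        then have "w (nxt n i) = 0" using nbs w[of "Suc s"] wrap n mn by (auto simp: J_def)
        then show ?thesis by simp
      next
        assume "j = Suc s"
        then have "w i = 0" using j w[of "Suc s"] n mn by (auto simp: J_def)
        then show ?thesis by simp
      next
        assume "j < s + n" "s < k"
        then have "{k, j, Suc j} \<subseteq> {s<..s + n}" using j k by auto
        moreover have "\<not> (k \<in> J \<and> j \<in> J \<and> Suc j \<in> J)"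
          using mn(3) n k \<open>j < s + n\<close> \<open>s < k\<close> by (auto simp: J_def)
        ultimately show ?thesis unfolding nbs unfolding j(2) by (auto simp: w)
      qed
    qed
    then show ?thesis by (auto simp: triple_free_def triples_def states_def w_def)
  qed
  obtain us where us: "set us \<subseteq> {1..n}" "z = run n us zb"
    using z zero_block_state_states n by (auto simp: fibonacci_orbit_def orbit201_eq zb_def)
  define v where "v = run n us w"
  have "coupled n A z v"
    unfolding us(2) v_def by (rule coupled_run[OF A \<open>coupled n A zb w\<close>])
  then have run_v: "run n as z i = run n as v i" if "i \<in> A" for as i
    using coupled_run[OF A, of z v as] that by (auto simp: coupled_def)
  have "v \<in> triple_free n" using run_triple_free[OF _ us(1) w_tf] n by (simp add: v_def)
  show ?thesis
  proof
    fix i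
    consider "i \<in> A" | "i \<in> {1..n}" "i \<notin> A" | "i \<notin> {1..n}" by blast
    then show "run n xs z i = run n ys z i"
    proof cases
      case 1
      then show ?thesis using run_v agree[OF \<open>v \<in> triple_free n\<close>] by simp
    next
      case 2
      obtain j where j: "j \<in> {s<..s + n}" "i = site n j" using site_surj[OF 2(1)] .
      with 2 have "frozen n zb i" using zb_frozen[of j] by (force simp: A_def)
      then have "frozen n zb (prv n i) \<or> frozen n zb (nxt n i)"
        using 2(1) by (auto simp: frozen_def prv_nxt nxt_prv)
      then have "run n as zb i = zb i" for as using run_next_to_frozen[OF 2(1)] by blast
      from this[of "us @ xs"] this[of "us @ ys"] show ?thesis by (simp add: us(2))
    next
      case 3
      have "z \<in> states n" using us zero_block_state_states run_states by (auto simp: zb_def)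
      then show ?thesis
        using run_states[OF xs] run_states[OF ys] 3 by (auto simp: states_def PiE_def extensional_def)
    qed
  qed
qed

lemma in_lucas_orbit:
  assumes "n \<ge> 2" "y \<in> states n" "\<And>i. i \<in> {1..n} \<Longrightarrow> \<not> frozen n y i"
  shows "y \<in> lucas_orbit n"
proof -
  have "(\<lambda>i\<in>{1..n}. if frozen n y i then 1 else 0) = zero_state n"
    using assms(3) by (auto simp: zero_state_def)
  then show ?thesis using in_orbit_of_frozen_part[OF assms(1,2)] by (simp add: lucas_orbit_def)
qed

lemma lucas_orbit_triple_free:
  assumes "n \<ge> 3"
  shows "lucas_orbit n \<subseteq> triple_free n"
proof -
  have "zero_state n \<in> triple_free n"
    by (auto simp: triple_free_def triples_def states_def zero_state_def)
  then show ?thesis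
    using assms run_triple_free zero_state_states by (auto simp: lucas_orbit_def orbit201_eq)
qed

text \<open>The values of a word are compared site by site. A site next to a frozen one keeps its value. At
  any other site, \<open>y\<close> is coupled on the surrounding gap to the state \<open>z\<close> that has ones outside of the
  gap, and \<open>z\<close> lies in a Fibonacci orbit because exactly the sites outside of the gap are frozen
  in it.\<close>

lemma orbits_agree_on_triple_free:
  assumes n: "n > 3" and xs: "set xs \<subseteq> {1..n}" and ys: "set ys \<subseteq> {1..n}"
    and lucas: "\<And>z. z \<in> lucas_orbit n \<Longrightarrow> run n xs z = run n ys z"
    and fib: "\<And>l m z. l \<in> {1..n} \<Longrightarrow> m \<in> {3..n - 5} \<union> {n - 2} \<Longrightarrow>
      z \<in> fibonacci_orbit n m l \<Longrightarrow> run n xs z = run n ys z"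
    and y: "y \<in> triple_free n"
  shows "run n xs y = run n ys y"
proof (cases "\<exists>f\<in>{1..n}. frozen n y f")
  case False
  have "y \<in> lucas_orbit n"
    using False y n by (intro in_lucas_orbit) (auto simp: triple_free_def)
  then show ?thesis by (rule lucas)
next
  case True
  then obtain f where f: "f \<in> {1..n}" "frozen n y f" by blast
  have y_st: "y \<in> states n" using y by (simp add: triple_free_def)
  show ?thesis
  proof
    fix i
    consider "i \<notin> {1..n}" | "i \<in> {1..n}" "frozen n y (prv n i) \<or> frozen n y (nxt n i)"
      | "i \<in> {1..n}" "\<not> frozen n y (prv n i)" "\<not> frozen n y (nxt n i)" by blast
    then show "run n xs y i = run n ys y i"
    proof cases
      case 1
      then show ?thesis using run_states[OF xs y_st] run_states[OF ys y_st]
        by (auto simp: states_def PiE_def extensional_def)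
    next
      case 2
      then show ?thesis using run_next_to_frozen by metis
    next
      case 3
      obtain s m where m: "m \<in> {3..n - 5} \<union> {n - 2}"
        and ends: "frozen n y (site n s)" "frozen n y (site n (Suc (s + m)))"
        and gap: "\<And>j. j \<in> {s<..s + m} \<Longrightarrow> \<not> frozen n y (site n j)"
        and i: "i \<in> site n ` {s<..s + m}"
        using gap_around[OF n y 3(1) f 3(2,3)] by metis
      have mn: "1 \<le> m" "m + 2 \<le> n" using m n by auto
      define A where "A = site n ` {s<..s + m}"
      have A: "A \<subseteq> {1..n}" using site_mem n by (auto simp: A_def)
      have in_A: "site n j \<in> A \<longleftrightarrow> j \<le> s + m" if "j \<in> {s<..s + n}" for j
      proof -
        have "{s<..s + m} \<subseteq> {s<..s + n}" using mn by auto
        then show ?thesis unfolding A_def using site_in_image[OF that] that by simp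
      qed
      define z where "z = (\<lambda>k\<in>{1..n}. if k \<in> A then y k else 1)"
      have zA: "z k = y k" if "k \<in> A" for k using that A by (auto simp: z_def)
      have zB: "z k = 1" if "k \<in> {1..n}" "k \<notin> A" for k using that by (auto simp: z_def)
      have boundary: "frozen n y j" if "k \<in> A" "j \<in> {prv n k, nxt n k} - A" for j k
        using neighbour_of_arc[of n k s m j] that ends n by (auto simp: A_def)
      have z_frozen_B: "frozen n z k" if k: "k \<in> {1..n}" "k \<notin> A" for k
      proof -
        obtain j where j: "j \<in> {s<..s + n}" "k = site n j" using site_surj[OF k(1)] .
        then have jm: "s + m < j" using in_A k by auto
        obtain j' where j': "j = Suc j'" using j by (cases j) auto
        have "z (prv n k) = 1 \<or> z (nxt n k) = 1"
        proof (cases "j = s + n")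
          case True
          then have "z (site n j') = 1" using in_A[of j'] j' mn n by (intro zB site_mem) auto
          then show ?thesis using j j' n by (simp add: prv_site)
        next
          case False
          then have "z (site n (Suc j)) = 1"
            using in_A[of "Suc j"] j jm n by (intro zB site_mem) auto
          then show ?thesis using j n by (simp add: nxt_site)
        qed
        then show ?thesis using zB[OF k] by (simp add: frozen_def)
      qed
      have z_frozen_A: "\<not> frozen n z k" if k: "k \<in> A" for k
      proof
        assume fk: "frozen n z k"
        have "\<not> frozen n y k" using k gap by (auto simp: A_def)
        moreover have "y k = 1" using fk zA[OF k] by (simp add: frozen_def)
        ultimately have 0: "y j = 0" if "j \<in> {prv n k, nxt n k}" for j
          using that by (auto simp: frozen_def)
        then have "j \<in> A" if "j \<in> {prv n k, nxt n k}" for j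
          using boundary[OF k, of j] that by (auto simp: frozen_def)
        then have "z j = 0" if "j \<in> {prv n k, nxt n k}" for j
          using that 0 zA by metis
        then show False using fk by (auto simp: frozen_def)
      qed
      have "(\<lambda>k\<in>{1..n}. if frozen n z k then 1 else 0) = zero_block_state n m (site n (Suc s))"
      proof
        fix k
        show "(\<lambda>k\<in>{1..n}. if frozen n z k then 1 else 0) k = zero_block_state n m (site n (Suc s)) k"
        proof (cases "k \<in> {1..n}")
          case True
          obtain j where j: "j \<in> {s<..s + n}" "k = site n j" using site_surj[OF True] .
          then show ?thesis
            using zero_block_state_site[of m n j s] mn in_A[of j] z_frozen_A z_frozen_B True by auto
        next
          case False
          then show ?thesis unfolding zero_block_state_def by (simp only: restrict_apply if_False)
        qed
      qed
      moreover have z_st: "z \<in> states n" by (simp add: z_def states_def)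
      ultimately have "z \<in> fibonacci_orbit n m (site n (Suc s))"
        using in_orbit_of_frozen_part[of n z] n by (simp add: fibonacci_orbit_def)
      then have eq: "run n xs z = run n ys z"
        using n by (intro fib[OF site_mem m]) auto
      have "coupled n A y z"
        unfolding coupled_def
      proof (intro ballI conjI)
        fix k assume k: "k \<in> A"
        then show "y k = z k" using zA by simp
        fix j assume j: "j \<in> {prv n k, nxt n k} - A"
        then show "frozen n y j" by (rule boundary[OF k])
        have "j \<in> {1..n}" using j k A prv_mem nxt_mem by blast
        then show "frozen n z j" using j z_frozen_B by simp
      qed
      then have "run n as y i = run n as z i" for as
        using coupled_run[OF A, of y z as] i by (auto simp: coupled_def A_def)
      then show ?thesis using eq by simp
    qed
  qed
qed


section \<open>Restriction to orbits\<close>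

lemma mult_dynamics_group_201:
  assumes "n \<ge> 2" "set xs \<subseteq> {1..n}" "set ys \<subseteq> {1..n}"
  shows "restrict (run n xs) (states n) \<otimes>\<^bsub>dynamics_group rule201 n\<^esub> restrict (run n ys) (states n)
     = restrict (run n (ys @ xs)) (states n)"
proof -
  have "restrict (run n zs) (states n) \<in> Bij (states n)" if "set zs \<subseteq> {1..n}" for zs
    unfolding run_def using that
    by (intro restrict_fold_in_Bij[where I = "{1..n}"])
      (auto simp: local_update_states local_update_201_involution[OF assms(1)])
  then show ?thesis
    using assms compose_restrict_fold[where I = "{1..n}" and ys = ys and xs = xs, OF local_update_states]
    by (simp add: dynamics_group_def BijGroup_def periodic_states_201 run_def)
qed

lemma restrict_hom_invariant:
  assumes n: "n \<ge> 2" and S: "S \<subseteq> states n"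
    and inv: "\<And>i z. i \<in> {1..n} \<Longrightarrow> z \<in> S \<Longrightarrow> local_update rule201 n i z \<in> S"
  shows "(\<lambda>g. restrict g S) \<in> hom (dynamics_group rule201 n) (BijGroup S)"
proof -
  have rr: "restrict (restrict (run n zs) (states n)) S = restrict (run n zs) S" for zs
    using S by (auto simp: fun_eq_iff)
  have bij: "restrict (run n zs) S \<in> Bij S" if "set zs \<subseteq> {1..n}" for zs
    unfolding run_def using that
    by (intro restrict_fold_in_Bij[where I = "{1..n}"])
      (auto simp: inv local_update_201_involution[OF n])
  show ?thesis
  proof (rule homI)
    fix g assume "g \<in> carrier (dynamics_group rule201 n)"
    then obtain xs where xs: "set xs \<subseteq> {1..n}" "g = restrict (run n xs) (states n)"
      using carrier_dynamics_group_201[OF n] by auto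
    then show "restrict g S \<in> carrier (BijGroup S)" using bij rr by (simp add: BijGroup_def)
  next
    fix g h
    assume "g \<in> carrier (dynamics_group rule201 n)" "h \<in> carrier (dynamics_group rule201 n)"
    then obtain xs ys where xs: "set xs \<subseteq> {1..n}" "g = restrict (run n xs) (states n)"
      and ys: "set ys \<subseteq> {1..n}" "h = restrict (run n ys) (states n)"
      using carrier_dynamics_group_201[OF n] by auto
    have "restrict (g \<otimes>\<^bsub>dynamics_group rule201 n\<^esub> h) S = restrict (run n (ys @ xs)) S"
      unfolding xs(2) ys(2) mult_dynamics_group_201[OF n xs(1) ys(1)] by (rule rr)
    also have "\<dots> = compose S (restrict (run n xs) S) (restrict (run n ys) S)"
      unfolding run_def using compose_restrict_fold[where I = "{1..n}", OF inv ys(1)] by simp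
    finally show "restrict (g \<otimes>\<^bsub>dynamics_group rule201 n\<^esub> h) S
        = restrict g S \<otimes>\<^bsub>BijGroup S\<^esub> restrict h S"
      using bij xs ys rr by (simp add: BijGroup_def)
  qed
qed

lemma restrict_hom_orbit:
  assumes "n \<ge> 2" "y \<in> states n"
  shows "(\<lambda>g. restrict g (orbit201 n y))
    \<in> hom (dynamics_group rule201 n) (restricted_group (dynamics_group rule201 n) (orbit201 n y))"
  using restrict_hom_invariant[OF assms(1) orbit201_subset_states[OF assms] orbit201_closed[OF assms]]
  by (auto simp: hom_def restricted_group_def)

lemma orbit_projection_hom:
  assumes "n \<ge> 2"
  shows "orbit_projection n \<in> hom (dynamics_group rule201 n) (lucas_fibonacci_product n)"
proof -
  note homs = restrict_hom_orbit[OF assms zero_state_states]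
    restrict_hom_orbit[OF assms zero_block_state_states]
  show ?thesis
  proof (rule homI)
    fix g assume "g \<in> carrier (dynamics_group rule201 n)"
    then show "orbit_projection n g \<in> carrier (lucas_fibonacci_product n)"
      by (auto simp: orbit_projection_def lucas_fibonacci_product_def lucas_group_def
          fibonacci_group_def restricted_group_def DirProd_def)
  next
    fix g h
    assume gh: "g \<in> carrier (dynamics_group rule201 n)" "h \<in> carrier (dynamics_group rule201 n)"
    show "orbit_projection n (g \<otimes>\<^bsub>dynamics_group rule201 n\<^esub> h)
        = orbit_projection n g \<otimes>\<^bsub>lucas_fibonacci_product n\<^esub> orbit_projection n h"
      using hom_mult[OF homs(1) gh] hom_mult[OF homs(2) gh]
      by (auto simp: orbit_projection_def lucas_fibonacci_product_def lucas_group_def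
          lucas_orbit_def fibonacci_group_def fibonacci_orbit_def intro!: restrict_ext)
  qed
qed

lemma restrict_eq_iff: "restrict f S = restrict g S \<longleftrightarrow> (\<forall>x\<in>S. f x = g x)"
  by (auto simp: fun_eq_iff restrict_def)

text \<open>Equal projections mean agreement on every orbit that defines a factor of the product, and these
  orbits determine the action on triple-free states and conversely.\<close>

lemma same_fibres:
  assumes n: "n > 3"
    and g: "g \<in> carrier (dynamics_group rule201 n)"
    and h: "h \<in> carrier (dynamics_group rule201 n)"
  shows "restrict g (triple_free n) = restrict h (triple_free n)
     \<longleftrightarrow> orbit_projection n g = orbit_projection n h"
proof -
  have n2: "n \<ge> 2" "n \<ge> 3" using n by auto
  obtain xs where xs: "set xs \<subseteq> {1..n}" "g = restrict (run n xs) (states n)"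
    using g carrier_dynamics_group_201[OF n2(1)] by auto
  obtain ys where ys: "set ys \<subseteq> {1..n}" "h = restrict (run n ys) (states n)"
    using h carrier_dynamics_group_201[OF n2(1)] by auto
  have agree: "restrict g S = restrict h S \<longleftrightarrow> (\<forall>z\<in>S. run n xs z = run n ys z)"
    if "S \<subseteq> states n" for S
    using that by (auto simp: restrict_eq_iff xs ys subset_iff)
  have sub: "triple_free n \<subseteq> states n" "lucas_orbit n \<subseteq> states n"
    "fibonacci_orbit n m l \<subseteq> states n" for m l
    using orbit201_subset_states[OF n2(1)] zero_state_states zero_block_state_states
    by (auto simp: triple_free_def lucas_orbit_def fibonacci_orbit_def)
  have "orbit_projection n g = orbit_projection n h \<longleftrightarrow>
      restrict g (lucas_orbit n) = restrict h (lucas_orbit n) \<and>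
      (\<forall>l\<in>{1..n}. \<forall>m\<in>{3..n - 5} \<union> {n - 2}.
         restrict g (fibonacci_orbit n m l) = restrict h (fibonacci_orbit n m l))"
    unfolding orbit_projection_def prod.inject restrict_eq_iff[of _ "{1..n}"]
      restrict_eq_iff[of _ "{3..n - 5}"]
    by auto
  also have "\<dots> \<longleftrightarrow> (\<forall>z\<in>triple_free n. run n xs z = run n ys z)"
    unfolding agree[OF sub(2)] agree[OF sub(3)]
  proof
    assume eq: "(\<forall>z\<in>lucas_orbit n. run n xs z = run n ys z) \<and>
      (\<forall>l\<in>{1..n}. \<forall>m\<in>{3..n - 5} \<union> {n - 2}. \<forall>z\<in>fibonacci_orbit n m l. run n xs z = run n ys z)"
    show "\<forall>z\<in>triple_free n. run n xs z = run n ys z"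
    proof
      fix z assume "z \<in> triple_free n"
      then show "run n xs z = run n ys z"
        by (rule orbits_agree_on_triple_free[OF n xs(1) ys(1), rotated 2])
          (simp_all only: eq[THEN conjunct1, rule_format] eq[THEN conjunct2, rule_format])
    qed
  next
    assume eq: "\<forall>z\<in>triple_free n. run n xs z = run n ys z"
    show "(\<forall>z\<in>lucas_orbit n. run n xs z = run n ys z) \<and>
      (\<forall>l\<in>{1..n}. \<forall>m\<in>{3..n - 5} \<union> {n - 2}. \<forall>z\<in>fibonacci_orbit n m l. run n xs z = run n ys z)"
    proof (intro conjI ballI)
      fix z assume "z \<in> lucas_orbit n"
      then show "run n xs z = run n ys z" using lucas_orbit_triple_free[OF n2(2)] eq by blast
    next
      fix l m z
      assume l: "l \<in> {1..n}" and m: "m \<in> {3..n - 5} \<union> {n - 2}"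
        and z: "z \<in> fibonacci_orbit n m l"
      show "run n xs z = run n ys z"
        by (rule triple_free_agree_on_fibonacci_orbits[OF n m l xs(1) ys(1) bspec[OF eq] z])
    qed
  qed
  finally show ?thesis using agree[OF sub(1)] by simp
qed

theorem theorem6p5:
  fixes n :: nat
  assumes "n > 3"
  shows "orbit_projection n \<in> hom (dynamics_group rule201 n) (lucas_fibonacci_product n) \<and>
    dynamics_group rule73 n \<cong>
      (lucas_fibonacci_product n)
        \<lparr>carrier := orbit_projection n ` carrier (dynamics_group rule201 n)\<rparr>"
proof
  have n2: "n \<ge> 2" "n \<ge> 3" using assms by auto
  show hom: "orbit_projection n \<in> hom (dynamics_group rule201 n) (lucas_fibonacci_product n)"
    by (rule orbit_projection_hom[OF n2(1)])
  let ?G = "dynamics_group rule201 n"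
  let ?f = "\<lambda>g. restrict g (triple_free n)"
  show "dynamics_group rule73 n \<cong>
      (lucas_fibonacci_product n)\<lparr>carrier := orbit_projection n ` carrier ?G\<rparr>"
  proof (rule iso_if_same_fibres[where G = ?G and f = ?f and p = "orbit_projection n"])
    have sub: "triple_free n \<subseteq> states n" by (auto simp: triple_free_def)
    show img: "?f ` carrier ?G = carrier (dynamics_group rule73 n)"
      unfolding carrier_dynamics_group_201[OF n2(1)] carrier_dynamics_group_73[OF n2(2)]
      by (simp add: setcompr_eq_image image_image Int_absorb1[OF sub])
    have "?f \<in> hom ?G (BijGroup (triple_free n))"
      by (rule restrict_hom_invariant[OF n2(1) sub local_update_201_triple_free[OF n2(2)]])
    then show "?f \<in> hom ?G (dynamics_group rule73 n)"
      using img by (auto simp: hom_def dynamics_group_def periodic_states_73[OF n2(2)])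
    show "orbit_projection n \<in> hom ?G
        ((lucas_fibonacci_product n)\<lparr>carrier := orbit_projection n ` carrier ?G\<rparr>)"
      using hom by (auto simp: hom_def)
  qed (simp_all add: group_dynamics_group same_fibres[OF assms])
qed

end
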